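(* Let $f:\mathbb R^n\to\mathbb R$ be continuously differentiable, $A\in\mathbb R^{m\times n}$ with $m\le n$, $\mathbf b\in\mathbb R^m$, let $s<m$ be a positive integer, and let $\tau>0$. Consider the problem $$(\mathrm P)\qquad \min_{\mathbf x\in\mathbb R^n} f(\mathbf x)\quad\text{s.t.}\quad \|(A\mathbf x-\mathbf b)_+\|_0\le s.$$ For $\mathbf x^*\in\mathbb R^n$ let $J_*=\{i\in\{1,\dots,m\}:(A\mathbf x^*-\mathbf b)_i=0\}$. Then $\mathbf x^*$ is a $\tau$-stationary point of $(\mathrm P)$ if and only if there is $\boldsymbol\lambda^*\in\mathbb R^m$ such that $J_*\in\mathbb T(A\mathbf x^*-\mathbf b+\tau\boldsymbol\lambda^*;s)$ and, with $\mathbf w^*=(\mathbf x^*;\boldsymbol\lambda^* )$, $$F(\mathbf w^*;J_* ):=\begin{bmatrix}\nabla f(\mathbf x^* )+A_{J_*}^\top\boldsymbol\lambda^*_{J_*}\\ A_{J_*}\mathbf x^*-\mathbf b_{J_*}\\ \boldsymbol\lambda^*_{\overline J_*}\end{bmatrix}=0.$$ Furthermore, if $f$ is twice continuously differentiable, then for the fixed index set $J_*$ the Jacobian of $F(\cdot;J_* )$ at $\mathbf w^*$, with variables ordered as $(\mathbf x;\boldsymbol\lambda_{J_*};\boldsymbol\lambda_{\overline J_*})$, is $$\nabla F(\mathbf w^*;J_* )=\begin{bmatrix}\nabla^2 f(\mathbf x^* )&A_{J_*}^\top&0\\ A_{J_*}&0&0\\ 0&0&I\end{bmatrix},$$ and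 it is non-singular if $f$ is twice continuously differentiable on $\mathbb R^n$, $\nabla^2 f(\mathbf x^* )$ is positive definite and $A_{J_*}$ has full row rank.
   Context: For $\mathbf u\in\mathbb R^m$, $\mathbf u_+$ is the entrywise positive part $\max\{u_i,0\}$ and $\|\cdot\|_0$ counts nonzero entries. For an index set $J\subseteq\{1,\dots,m\}$, $\overline J$ is its complement, $A_J$ and $\mathbf u_J$ are the submatrix of rows and the subvector indexed by $J$. Let $S=\{\mathbf u\in\mathbb R^m:\|\mathbf u_+\|_0\le s\}$ and $\mathbb P_S(\mathbf z)=\operatorname{argmin}\{\|\mathbf z-\mathbf u\|:\mathbf u\in S\}$ (Euclidean norm; the set of all minimizers). A point $\mathbf x^*$ is a $\tau$-stationary point of $(\mathrm P)$ if there is $\boldsymbol\lambda^*\in\mathbb R^m$ such that $\nabla f(\mathbf x^* )+A^\top\boldsymbol\lambda^*=0$ and $A\mathbf x^*-\mathbf b\in\mathbb P_S(A\mathbf x^*-\mathbf b+\tau\boldsymbol\lambda^* )$. For $\mathbf z\in\mathbb R^m$ put $\Gamma_+=\{i:z_i>0\}$, $\Gamma_0=\{i:z_i=0\}$; $\mathbb T(\mathbf z;s)$ is the collection of all index sets $T=(\Gamma_+\setminus\Gamma_s)\cup\Gamma_0$, where $\Gamma_s$ ranges over all subsets $\Gamma_s\subseteq\Gamma_+$ with $|\Gamma_s|=\min\{s,|\Gamma_+|\}$ such that $z_i\ge z_j\ge 0$ for all $i\in\Gamma_s$, $j\in T$. *)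

theory Defs
  imports "HOL-Analysis.Analysis"
begin

section \<open>Gradient, Hessian and smoothness\<close>

definition gradient :: "(real ^ 'n \<Rightarrow> real) \<Rightarrow> real ^ 'n \<Rightarrow> real ^ 'n" where
  "gradient f x = (THE g. GDERIV f x :> g)"

definition hessian :: "(real ^ 'n \<Rightarrow> real) \<Rightarrow> real ^ 'n \<Rightarrow> real ^ 'n ^ 'n" where
  "hessian f x = jacobian (gradient f) (at x)"

definition continuously_differentiable :: "(real ^ 'n \<Rightarrow> real) \<Rightarrow> bool" where
  "continuously_differentiable f \<longleftrightarrow>
     (\<forall>x. f differentiable (at x)) \<and> continuous_on UNIV (gradient f)"

definition twice_continuously_differentiable :: "(real ^ 'n \<Rightarrow> real) \<Rightarrow> bool" where
  "twice_continuously_differentiable f \<longleftrightarrow>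
     continuously_differentiable f \<and>
     (\<forall>x. gradient f differentiable (at x)) \<and> continuous_on UNIV (hessian f)"

text \<open>Symmetry is not part of this definition; it is only applied to Hessians of twice
  continuously differentiable functions, which are symmetric.\<close>

definition positive_definite :: "real ^ 'n ^ 'n \<Rightarrow> bool" where
  "positive_definite M \<longleftrightarrow> (\<forall>v. v \<noteq> 0 \<longrightarrow> v \<bullet> (M *v v) > 0)"


section \<open>The step-constrained problem and its stationary points\<close>

text \<open>The index set \<open>{1, \<dots>, m}\<close> is a finite type \<open>'m\<close> with \<open>m = CARD('m)\<close>.\<close>

definition pos_part :: "real ^ 'm \<Rightarrow> real ^ 'm" where
  "pos_part u = (\<chi> i. max (u $ i) 0)"

definition norm0 :: "real ^ 'm \<Rightarrow> nat" where
  "norm0 u = card {i. u $ i \<noteq> 0}"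

definition S_set :: "nat \<Rightarrow> (real ^ 'm) set" where
  "S_set s = {u. norm0 (pos_part u) \<le> s}"

definition proj_set :: "(real ^ 'm) set \<Rightarrow> real ^ 'm \<Rightarrow> (real ^ 'm) set" where
  "proj_set S z = {u. is_arg_min (\<lambda>u. norm (z - u)) (\<lambda>u. u \<in> S) u}"

definition tau_stationary ::
    "(real ^ 'n \<Rightarrow> real) \<Rightarrow> real ^ 'n ^ 'm \<Rightarrow> real ^ 'm \<Rightarrow> nat \<Rightarrow> real \<Rightarrow> real ^ 'n \<Rightarrow> bool" where
  "tau_stationary f A b s \<tau> x \<longleftrightarrow>
     (\<exists>l :: real ^ 'm. gradient f x + transpose A *v l = 0 \<and>
        A *v x - b \<in> proj_set (S_set s) (A *v x - b + \<tau> *\<^sub>R l))"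

definition T_sets :: "real ^ 'm \<Rightarrow> nat \<Rightarrow> 'm set set" where
  "T_sets z s =
     (let Gpos = {i. z $ i > 0}; Gzero = {i. z $ i = 0} in
      {T. \<exists>Gs. Gs \<subseteq> Gpos \<and> card Gs = min s (card Gpos) \<and>
            T = (Gpos - Gs) \<union> Gzero \<and>
            (\<forall>i\<in>Gs. \<forall>j\<in>T. z $ i \<ge> z $ j \<and> z $ j \<ge> 0)})"


section \<open>The stationary equation and its Jacobian\<close>

text \<open>A vector with three blocks, of sizes \<open>n\<close>, \<open>card J\<close> and \<open>m - card J\<close>, is
  indexed by \<open>'n + 'm\<close>: the indices \<open>Inl j\<close> form the first block, \<open>Inr i\<close> with
  \<open>i \<in> J\<close> the second one, and \<open>Inr i\<close> with \<open>i \<notin> J\<close> the third one.  In this way the block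
  sizes may depend on \<open>J\<close>, while entries keep their original labels.
  In \<open>stack3\<close> and \<open>block3\<close> the arguments for the second and third block are read only at the
  indices in \<open>J\<close> and in \<open>- J\<close>, respectively.  Thus \<open>v\<close> passed as second block
  stands for the subvector \<open>v\<^sub>J\<close>, and \<open>A\<close> and \<open>transpose A\<close> passed in
  the positions (2,1) and (1,2) stand for the submatrix \<open>A\<^sub>J\<close> and for its transpose.\<close>

definition stack3 :: "'m set \<Rightarrow> real ^ 'n \<Rightarrow> real ^ 'm \<Rightarrow> real ^ 'm \<Rightarrow> real ^ ('n::finite + 'm::finite)" where
  "stack3 J u v w =
     (\<chi> r. case r of Inl j \<Rightarrow> u $ j | Inr i \<Rightarrow> if i \<in> J then v $ i else w $ i)"

definition block3 :: "'m set \<Rightarrow>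
    real ^ 'n ^ 'n \<Rightarrow> real ^ 'm ^ 'n \<Rightarrow> real ^ 'm ^ 'n \<Rightarrow>
    real ^ 'n ^ 'm \<Rightarrow> real ^ 'm ^ 'm \<Rightarrow> real ^ 'm ^ 'm \<Rightarrow>
    real ^ 'n ^ 'm \<Rightarrow> real ^ 'm ^ 'm \<Rightarrow> real ^ 'm ^ 'm \<Rightarrow>
    real ^ ('n::finite + 'm::finite) ^ ('n::finite + 'm::finite)" where
  "block3 J M11 M12 M13 M21 M22 M23 M31 M32 M33 =
     (\<chi> r c. case r of
        Inl i \<Rightarrow>
          (case c of Inl j \<Rightarrow> M11 $ i $ j
           | Inr j \<Rightarrow> if j \<in> J then M12 $ i $ j else M13 $ i $ j)
      | Inr i \<Rightarrow>
          if i \<in> J then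
            (case c of Inl j \<Rightarrow> M21 $ i $ j
             | Inr j \<Rightarrow> if j \<in> J then M22 $ i $ j else M23 $ i $ j)
          else
            (case c of Inl j \<Rightarrow> M31 $ i $ j
             | Inr j \<Rightarrow> if j \<in> J then M32 $ i $ j else M33 $ i $ j))"

definition pair_vec :: "real ^ 'n \<Rightarrow> real ^ 'm \<Rightarrow> real ^ ('n::finite + 'm::finite)" where
  "pair_vec x l = (\<chi> r. case r of Inl j \<Rightarrow> x $ j | Inr i \<Rightarrow> l $ i)"

definition x_part :: "real ^ ('n::finite + 'm::finite) \<Rightarrow> real ^ 'n" where
  "x_part w = (\<chi> j. w $ Inl j)"

definition l_part :: "real ^ ('n::finite + 'm::finite) \<Rightarrow> real ^ 'm" where
  "l_part w = (\<chi> i. w $ Inr i)"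

text \<open>The product \<open>A\<^sub>J\<^sup>T l\<^sub>J\<close>, written as the combination of the rows of \<open>A\<^sub>J\<close>.\<close>

definition sub_transpose_mult :: "real ^ 'n ^ 'm \<Rightarrow> 'm set \<Rightarrow> real ^ 'm \<Rightarrow> real ^ 'n" where
  "sub_transpose_mult A J l = (\<Sum>i\<in>J. l $ i *\<^sub>R row i A)"

definition F_map ::
    "(real ^ 'n \<Rightarrow> real) \<Rightarrow> real ^ 'n ^ 'm \<Rightarrow> real ^ 'm \<Rightarrow> 'm set \<Rightarrow>
     real ^ ('n::finite + 'm::finite) \<Rightarrow> real ^ ('n::finite + 'm::finite)" where
  "F_map f A b J w =
     stack3 J
       (gradient f (x_part w) + sub_transpose_mult A J (l_part w))
       (A *v x_part w - b)
       (l_part w)"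

text \<open>The row rank of \<open>A\<^sub>J\<close> equals its number of rows.\<close>

definition full_row_rank :: "real ^ 'n ^ 'm \<Rightarrow> 'm set \<Rightarrow> bool" where
  "full_row_rank A J \<longleftrightarrow> dim {row i A | i. i \<in> J} = card J"

end

theory Submission
  imports Defs
begin

text \<open>
  Write \<open>u = A x - b\<close> and \<open>z = u + \<tau> l\<close>.  The equivalence is a statement about
  Euclidean projection onto \<open>S\<close> alone: \<open>u\<close> is a nearest point of \<open>S\<close> to \<open>z\<close> iff \<open>u\<close> agrees
  with \<open>z\<close> off its own zero set and that zero set belongs to \<open>T_sets z s\<close>
  (\<open>proj_S_iff_zero_set_in_T_sets\<close>).  Indeed, the squared distance is a sum over coordinates,
  and membership in \<open>S\<close> only limits the number of positive ones.  Hence a nearest point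
  leaves every nonpositive coordinate of \<open>z\<close> alone, keeps as many positive ones as the budget
  \<open>s\<close> permits, and sets the others to zero; the loss is the sum of squares of the
  discarded coordinates, so the kept ones have to be the largest.  In one direction this is a
  local exchange argument (change one or two coordinates of \<open>u\<close>), in the other a
  comparison of sums of squares over two index sets.

  Since \<open>z - u = \<tau> l\<close> and \<open>\<tau> \<noteq> 0\<close>, agreement of \<open>u\<close> and \<open>z\<close> off \<open>J\<close> says exactly that \<open>l\<close> vanishes
  off \<open>J\<close>.  This is the third block of \<open>F = 0\<close>; it also makes the first block the equation
  \<open>\<nabla>f(x) + A\<^sup>T l = 0\<close>, while the second block holds by the choice of \<open>J\<close>.

  For fixed \<open>J\<close>, the map \<open>F\<close> is the gradient of \<open>f\<close> composed with linear maps, plus an affine map,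
  which gives the Jacobian.  It is a saddle-point matrix: if \<open>(p, q)\<close> lies in its kernel,
  then \<open>A\<^sub>J p = 0\<close>, so pairing the first block with \<open>p\<close> removes the multiplier term and leaves
  \<open>p \<bullet> H p = 0\<close>.  Positive definiteness gives \<open>p = 0\<close>, and linear independence of the rows of
  \<open>A\<^sub>J\<close> then gives \<open>q = 0\<close>.
\<close>

section \<open>Projection onto the step constraint set\<close>

lemma S_set_iff_card_pos: "u \<in> S_set s \<longleftrightarrow> card {i. u $ i > 0} \<le> s"
proof -
  have "{i. pos_part u $ i \<noteq> 0} = {i. u $ i > 0}"
    by (auto simp: pos_part_def max_def)
  then show ?thesis by (simp add: S_set_def norm0_def)
qed

lemma proj_set_iff:
  "u \<in> proj_set S z \<longleftrightarrow> u \<in> S \<and> (\<forall>v\<in>S. norm (z - u) \<le> norm (z - v))"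
  by (auto simp: proj_set_def is_arg_min_linorder)

lemma norm_diff_le_iff_sum_squares:
  fixes z u v :: "real ^ 'm"
  shows "norm (z - u) \<le> norm (z - v) \<longleftrightarrow>
    (\<Sum>i\<in>UNIV. (z $ i - u $ i)\<^sup>2) \<le> (\<Sum>i\<in>UNIV. (z $ i - v $ i)\<^sup>2)"
  by (simp add: norm_vec_def L2_set_def)

text \<open>Because the squared distance splits over coordinates, a competitor that differs from a
  nearest point only on \<open>K\<close> can be compared on \<open>K\<close> alone.\<close>

lemma proj_S_local_optimality:
  fixes z u v :: "real ^ 'm"
  assumes u: "u \<in> proj_set (S_set s) z"
    and v: "card {i. v $ i > 0} \<le> s"
    and off: "\<And>i. i \<notin> K \<Longrightarrow> v $ i = u $ i"
  shows "(\<Sum>i\<in>K. (z $ i - u $ i)\<^sup>2) \<le> (\<Sum>i\<in>K. (z $ i - v $ i)\<^sup>2)"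
proof -
  have split: "(\<Sum>i\<in>UNIV. g i) = (\<Sum>i\<in>K. g i) + (\<Sum>i\<in>-K. g i)" for g :: "'m \<Rightarrow> real"
    by (metis Compl_eq_Diff_UNIV add.commute finite subset_UNIV sum.subset_diff)
  have "(\<Sum>i\<in>UNIV. (z $ i - u $ i)\<^sup>2) \<le> (\<Sum>i\<in>UNIV. (z $ i - v $ i)\<^sup>2)"
    using u v by (simp add: proj_set_iff S_set_iff_card_pos norm_diff_le_iff_sum_squares)
  moreover have "(\<Sum>i\<in>-K. (z $ i - v $ i)\<^sup>2) = (\<Sum>i\<in>-K. (z $ i - u $ i)\<^sup>2)"
    by (rule sum.cong) (auto simp: off)
  ultimately show ?thesis by (simp add: split)
qed

lemma proj_S_single_coordinate:
  fixes z u :: "real ^ 'm"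
  assumes u: "u \<in> proj_set (S_set s) z"
    and t: "t \<le> 0 \<or> u $ k > 0 \<or> card {i. u $ i > 0} < s"
  shows "(z $ k - u $ k)\<^sup>2 \<le> (z $ k - t)\<^sup>2"
proof -
  define v where "v = (\<chi> i. if i = k then t else u $ i)"
  have cu: "card {i. u $ i > 0} \<le> s"
    using u by (simp add: proj_set_iff S_set_iff_card_pos)
  have "card {i. v $ i > 0} \<le> s"
  proof (cases "t \<le> 0 \<or> u $ k > 0")
    case True
    then have "{i. v $ i > 0} \<subseteq> {i. u $ i > 0}" by (auto simp: v_def)
    then have "card {i. v $ i > 0} \<le> card {i. u $ i > 0}" by (intro card_mono) auto
    then show ?thesis using cu by simp
  next
    case False
    then have less: "card {i. u $ i > 0} < s" using t by simp
    have "{i. v $ i > 0} \<subseteq> insert k {i. u $ i > 0}" by (auto simp: v_def split: if_splits)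
    then have "card {i. v $ i > 0} \<le> card (insert k {i. u $ i > 0})" by (intro card_mono) auto
    also have "\<dots> \<le> Suc (card {i. u $ i > 0})" by (simp add: card_insert_if)
    finally show ?thesis using less by simp
  qed
  then have "(\<Sum>i\<in>{k}. (z $ i - u $ i)\<^sup>2) \<le> (\<Sum>i\<in>{k}. (z $ i - v $ i)\<^sup>2)"
    by (rule proj_S_local_optimality[OF u]) (simp add: v_def)
  then show ?thesis by (simp add: v_def)
qed

text \<open>Where \<open>u\<close> is nonzero it must agree with \<open>z\<close>: otherwise move that coordinate to \<open>z $ k\<close>, or, if
  this would create a new positive entry, only to \<open>0\<close>, which is already closer.\<close>

lemma proj_S_agrees_off_zero_set:
  assumes u: "u \<in> proj_set (S_set s) z" and nz: "u $ k \<noteq> 0"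
  shows "u $ k = z $ k"
proof (cases "z $ k \<le> 0 \<or> u $ k > 0")
  case True
  then have "(z $ k - u $ k)\<^sup>2 \<le> (z $ k - z $ k)\<^sup>2"
    by (intro proj_S_single_coordinate[OF u]) auto
  then show ?thesis by simp
next
  case False
  have "(z $ k - u $ k)\<^sup>2 \<le> (z $ k - 0)\<^sup>2"
    by (rule proj_S_single_coordinate[OF u]) simp
  moreover have "(z $ k - 0)\<^sup>2 < (z $ k - u $ k)\<^sup>2"
    using False nz by (intro power_strict_mono) auto
  ultimately show ?thesis by simp
qed

lemma proj_S_zero_imp_nonneg:
  assumes u: "u \<in> proj_set (S_set s) z" and zero: "u $ k = 0"
  shows "z $ k \<ge> 0"
proof (rule ccontr)
  assume "\<not> z $ k \<ge> 0"
  then have "(z $ k - u $ k)\<^sup>2 \<le> (z $ k - z $ k)\<^sup>2"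
    by (intro proj_S_single_coordinate[OF u]) auto
  then show False using zero \<open>\<not> z $ k \<ge> 0\<close> by simp
qed

text \<open>Discarding \<open>i\<close> and keeping \<open>j\<close> in its place does not increase the number of positive
  entries, and it changes the loss on these two coordinates from \<open>z\<^sub>j\<^sup>2\<close> to \<open>z\<^sub>i\<^sup>2\<close>.\<close>

lemma proj_S_kept_ge_discarded:
  fixes z u :: "real ^ 'm"
  assumes u: "u \<in> proj_set (S_set s) z" and i: "u $ i > 0" and j: "u $ j = 0"
  shows "z $ j \<le> z $ i"
proof -
  define v where "v = (\<chi> k. if k = i then 0 else if k = j then z $ j else u $ k)"
  have ij: "i \<noteq> j" using i j by auto
  have ui: "u $ i = z $ i" using proj_S_agrees_off_zero_set[OF u] i by simp
  have "{k. v $ k > 0} \<subseteq> insert j ({k. u $ k > 0} - {i})"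
    by (auto simp: v_def split: if_splits)
  then have "card {k. v $ k > 0} \<le> card (insert j ({k. u $ k > 0} - {i}))"
    by (intro card_mono) auto
  also have "\<dots> \<le> Suc (card ({k. u $ k > 0} - {i}))" by (simp add: card_insert_if)
  also have "\<dots> = card {k. u $ k > 0}"
    by (rule card_Suc_Diff1) (auto simp: i)
  also have "\<dots> \<le> s" using u by (simp add: proj_set_iff S_set_iff_card_pos)
  finally have "card {k. v $ k > 0} \<le> s" .
  then have "(\<Sum>k\<in>{i, j}. (z $ k - u $ k)\<^sup>2) \<le> (\<Sum>k\<in>{i, j}. (z $ k - v $ k)\<^sup>2)"
    by (rule proj_S_local_optimality[OF u]) (simp add: v_def)
  then have "(z $ j)\<^sup>2 \<le> (z $ i)\<^sup>2" using ij ui j by (simp add: v_def)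
  then show ?thesis using i ui by (simp add: abs_le_square_iff[symmetric])
qed

lemma proj_S_imp_zero_set_in_T_sets:
  fixes z u :: "real ^ 'm"
  assumes u: "u \<in> proj_set (S_set s) z"
  shows "{i. u $ i = 0} \<in> T_sets z s"
proof -
  define P where "P = {i. z $ i > 0}"
  define G where "G = {i. u $ i > 0}"
  note agree = proj_S_agrees_off_zero_set[OF u]
  note nonneg = proj_S_zero_imp_nonneg[OF u]
  have sub: "G \<subseteq> P" using agree by (fastforce simp: G_def P_def)
  have card_le: "card G \<le> s"
    using u by (simp add: G_def proj_set_iff S_set_iff_card_pos)
  have card_G: "card G = min s (card P)"
  proof (cases "card G < s")
    case True
    have "P \<subseteq> G"
    proof
      fix k assume k: "k \<in> P"
      have "(z $ k - u $ k)\<^sup>2 \<le> (z $ k - z $ k)\<^sup>2"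
        by (rule proj_S_single_coordinate[OF u]) (use True in \<open>simp add: G_def\<close>)
      then show "k \<in> G" using k by (simp add: G_def P_def)
    qed
    then show ?thesis using sub card_le by simp
  next
    case False
    have "card G \<le> card P" using sub by (intro card_mono) auto
    then show ?thesis using False card_le by simp
  qed
  have zero_set: "{i. u $ i = 0} = (P - G) \<union> {i. z $ i = 0}"
  proof (intro set_eqI)
    fix i
    show "i \<in> {i. u $ i = 0} \<longleftrightarrow> i \<in> (P - G) \<union> {i. z $ i = 0}"
      using agree[of i] nonneg[of i] by (cases "u $ i = 0") (auto simp: P_def G_def)
  qed
  have order: "\<forall>i\<in>G. \<forall>j\<in>{i. u $ i = 0}. z $ i \<ge> z $ j \<and> z $ j \<ge> 0"
    using proj_S_kept_ge_discarded[OF u] nonneg by (auto simp: G_def)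
  show ?thesis
    unfolding T_sets_def Let_def mem_Collect_eq
    using sub card_G zero_set order unfolding P_def by blast
qed

text \<open>A top selection carries the largest sum: cancel the common part \<open>P \<inter> G\<close>; what remains of
  \<open>P\<close> has at most as many terms as what remains of \<open>G\<close>, and the larger of \<open>0\<close> and
  the greatest of its terms separates the two.\<close>

lemma sum_le_sum_of_top_selection:
  fixes g :: "'a \<Rightarrow> real"
  assumes fin: "finite P" "finite G"
    and card: "card P \<le> card G"
    and top: "\<And>i j. i \<in> G \<Longrightarrow> j \<in> P - G \<Longrightarrow> g j \<le> g i"
    and nonneg: "\<And>i. i \<in> G \<Longrightarrow> g i \<ge> 0"
  shows "sum g P \<le> sum g G"
proof -
  have splitP: "sum g P = sum g (P \<inter> G) + sum g (P - G)"
    by (rule sum.Int_Diff[OF fin(1)])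
  have splitG: "sum g G = sum g (P \<inter> G) + sum g (G - P)"
    using fin sum.Int_Diff[of G g P] by (simp add: Int_commute)
  have cards: "card (P - G) \<le> card (G - P)"
  proof -
    have "card (P - G) + card (P \<inter> G) = card P"
      using fin by (metis card_Diff_subset_Int card_mono finite_Int inf_le1 le_add_diff_inverse2)
    moreover have "card (G - P) + card (P \<inter> G) = card G"
      using fin by (metis card_Diff_subset_Int card_mono finite_Int inf_commute inf_le1
          le_add_diff_inverse2)
    ultimately show ?thesis using card by linarith
  qed
  have "sum g (P - G) \<le> sum g (G - P)"
  proof (cases "P - G = {}")
    case True
    have "0 \<le> sum g (G - P)" by (rule sum_nonneg) (auto intro: nonneg)
    then show ?thesis by (simp only: True sum.empty)
  next
    case False
    define c where "c = Max (g ` (P - G))"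
    have "c \<in> g ` (P - G)" unfolding c_def using fin False by (intro Max_in) auto
    then obtain k where k: "k \<in> P - G" "c = g k" by auto
    have lower: "c \<le> g i" if "i \<in> G - P" for i using top k that by auto
    have "sum g (P - G) \<le> of_nat (card (P - G)) * c"
      by (rule sum_bounded_above) (use fin in \<open>auto simp: c_def\<close>)
    \<comment> \<open>\<open>g\<close> may be negative on \<open>P - G\<close>, and only a nonnegative factor permits passing to the larger
      cardinality.\<close>
    also have "\<dots> \<le> of_nat (card (P - G)) * max c 0"
      by (intro mult_left_mono) auto
    also have "\<dots> \<le> of_nat (card (G - P)) * max c 0"
      using cards by (intro mult_right_mono) auto
    also have "\<dots> \<le> sum g (G - P)"
      by (rule sum_bounded_below) (use lower nonneg in auto)
    finally show ?thesis .
  qed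
  then show ?thesis using splitP splitG by simp
qed

text \<open>Every point of \<open>S\<close> has squared distance from \<open>z\<close> at least the sum of squares of the positive
  entries of \<open>z\<close> at which it is not positive.  For \<open>u\<close> this sum is attained, with the largest
  entries left out of it.\<close>

lemma T_sets_imp_proj_S:
  fixes z u :: "real ^ 'm"
  assumes T: "{i. u $ i = 0} \<in> T_sets z s"
    and agree: "\<And>i. u $ i \<noteq> 0 \<Longrightarrow> u $ i = z $ i"
  shows "u \<in> proj_set (S_set s) z"
proof -
  define P where "P = {i. z $ i > 0}"
  obtain G where G: "G \<subseteq> P" "card G = min s (card P)"
    "{i. u $ i = 0} = (P - G) \<union> {i. z $ i = 0}"
    "\<And>i j. i \<in> G \<Longrightarrow> u $ j = 0 \<Longrightarrow> z $ i \<ge> z $ j \<and> z $ j \<ge> 0"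
    using T unfolding T_sets_def Let_def P_def by blast
  have zero_iff: "u $ i = 0 \<longleftrightarrow> i \<in> P - G \<or> z $ i = 0" for i
    using G(3) by blast
  have "{i. u $ i > 0} \<subseteq> G"
  proof
    fix i assume "i \<in> {i. u $ i > 0}"
    then show "i \<in> G" using zero_iff[of i] agree[of i] by (auto simp: P_def)
  qed
  then have "card {i. u $ i > 0} \<le> card G" by (intro card_mono) auto
  then have feasible: "u \<in> S_set s" using G(2) by (simp add: S_set_iff_card_pos)
  have loss: "(\<Sum>i\<in>UNIV. (z $ i - u $ i)\<^sup>2) = (\<Sum>i\<in>P - G. (z $ i)\<^sup>2)"
  proof (rule sum.mono_neutral_cong_right)
    show "\<forall>i\<in>UNIV - (P - G). (z $ i - u $ i)\<^sup>2 = 0"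
      using zero_iff agree by fastforce
    show "(z $ i - u $ i)\<^sup>2 = (z $ i)\<^sup>2" if "i \<in> P - G" for i
      using zero_iff[of i] that by simp
  qed auto
  have "norm (z - u) \<le> norm (z - v)" if v: "v \<in> S_set s" for v
  proof -
    define Q where "Q = P \<inter> {i. v $ i > 0}"
    have "card Q \<le> card {i. v $ i > 0}" unfolding Q_def by (intro card_mono) auto
    moreover have "card Q \<le> card P" unfolding Q_def by (intro card_mono) auto
    ultimately have cardQ: "card Q \<le> card G"
      using v G(2) by (simp add: S_set_iff_card_pos)
    have top: "(\<Sum>i\<in>Q. (z $ i)\<^sup>2) \<le> (\<Sum>i\<in>G. (z $ i)\<^sup>2)"
    proof (rule sum_le_sum_of_top_selection[OF _ _ cardQ])
      fix i j assume "i \<in> G" "j \<in> Q - G"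
      then have "z $ j \<le> z $ i \<and> 0 \<le> z $ j"
        using G(4) zero_iff by (simp add: Q_def)
      then show "(z $ j)\<^sup>2 \<le> (z $ i)\<^sup>2" by (intro power_mono) auto
    qed auto
    have "(\<Sum>i\<in>P - G. (z $ i)\<^sup>2) = (\<Sum>i\<in>P. (z $ i)\<^sup>2) - (\<Sum>i\<in>G. (z $ i)\<^sup>2)"
      using G(1) by (simp add: sum_diff)
    also have "\<dots> \<le> (\<Sum>i\<in>P. (z $ i)\<^sup>2) - (\<Sum>i\<in>Q. (z $ i)\<^sup>2)" using top by simp
    also have "\<dots> = (\<Sum>i\<in>P - Q. (z $ i)\<^sup>2)"
      by (rule sum_diff[symmetric]) (auto simp: Q_def)
    also have "\<dots> \<le> (\<Sum>i\<in>P - Q. (z $ i - v $ i)\<^sup>2)"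
      by (intro sum_mono power_mono) (auto simp: P_def Q_def)
    also have "\<dots> \<le> (\<Sum>i\<in>UNIV. (z $ i - v $ i)\<^sup>2)"
      by (rule sum_mono2) auto
    finally show ?thesis
      using loss by (simp add: norm_diff_le_iff_sum_squares)
  qed
  then show ?thesis using feasible by (simp add: proj_set_iff)
qed

lemma proj_S_iff_zero_set_in_T_sets:
  fixes z u :: "real ^ 'm"
  shows "u \<in> proj_set (S_set s) z \<longleftrightarrow>
    {i. u $ i = 0} \<in> T_sets z s \<and> (\<forall>i. u $ i \<noteq> 0 \<longrightarrow> u $ i = z $ i)"
  using proj_S_imp_zero_set_in_T_sets proj_S_agrees_off_zero_set T_sets_imp_proj_S by blast


section \<open>Stationarity as an equation\<close>

lemma x_part_pair_vec [simp]: "x_part (pair_vec x l) = x"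
  by (simp add: x_part_def pair_vec_def vec_eq_iff)

lemma l_part_pair_vec [simp]: "l_part (pair_vec x l) = l"
  by (simp add: l_part_def pair_vec_def vec_eq_iff)

lemma stack3_eq_0_iff:
  "stack3 J u v w = 0 \<longleftrightarrow> u = 0 \<and> (\<forall>i\<in>J. v $ i = 0) \<and> (\<forall>i. i \<notin> J \<longrightarrow> w $ i = 0)"
proof -
  have "stack3 J u v w = 0 \<longleftrightarrow>
      (\<forall>j. stack3 J u v w $ Inl j = 0) \<and> (\<forall>i. stack3 J u v w $ Inr i = 0)"
    unfolding vec_eq_iff zero_index by (metis sum.exhaust)
  then show ?thesis by (auto simp: stack3_def vec_eq_iff)
qed

lemma sub_transpose_mult_component:
  "sub_transpose_mult A J l $ j = (\<Sum>i\<in>J. l $ i * A $ i $ j)"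
  by (simp add: sub_transpose_mult_def row_def)

lemma sub_transpose_mult_eq_transpose_mult:
  assumes "\<And>i. i \<notin> J \<Longrightarrow> l $ i = 0"
  shows "sub_transpose_mult A J l = transpose A *v l"
proof -
  have "(\<Sum>i\<in>J. l $ i * A $ i $ j) = (\<Sum>i\<in>UNIV. A $ i $ j * l $ i)" for j
    by (rule sum.mono_neutral_cong_left) (use assms in \<open>auto simp: mult.commute\<close>)
  then show ?thesis
    by (simp add: vec_eq_iff sub_transpose_mult_component matrix_vector_mult_def transpose_def)
qed

lemma F_map_eq_0_iff:
  assumes J: "J = {i. (A *v x - b) $ i = 0}"
  shows "F_map f A b J (pair_vec x l) = 0 \<longleftrightarrow>
    gradient f x + transpose A *v l = 0 \<and> (\<forall>i. i \<notin> J \<longrightarrow> l $ i = 0)"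
  using J sub_transpose_mult_eq_transpose_mult[of J l A]
  by (auto simp: F_map_def stack3_eq_0_iff)

lemma tau_stationary_iff_F_map_eq_0:
  fixes x :: "real ^ 'n" and A :: "real ^ 'n ^ 'm"
  assumes tau: "\<tau> \<noteq> 0" and J: "J = {i. (A *v x - b) $ i = 0}"
  shows "tau_stationary f A b s \<tau> x \<longleftrightarrow>
    (\<exists>l. J \<in> T_sets (A *v x - b + \<tau> *\<^sub>R l) s \<and> F_map f A b J (pair_vec x l) = 0)"
proof -
  have "A *v x - b \<in> proj_set (S_set s) (A *v x - b + \<tau> *\<^sub>R l) \<longleftrightarrow>
      J \<in> T_sets (A *v x - b + \<tau> *\<^sub>R l) s \<and> (\<forall>i. i \<notin> J \<longrightarrow> l $ i = 0)" for l
    unfolding proj_S_iff_zero_set_in_T_sets using J tau by simp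
  then show ?thesis
    unfolding tau_stationary_def F_map_eq_0_iff[OF J] by blast
qed


section \<open>The Jacobian of the stationary equation\<close>

lemma linear_x_part: "linear x_part"
  by (rule linearI) (simp_all add: x_part_def vec_eq_iff)

lemma linear_l_part: "linear l_part"
  by (rule linearI) (simp_all add: l_part_def vec_eq_iff)

lemma linear_sub_transpose_mult: "linear (sub_transpose_mult A J)"
  by (rule linearI)
    (simp_all add: sub_transpose_mult_def scaleR_add_left sum.distrib scaleR_sum_right)

lemma linear_stack3: "linear (\<lambda>(u, v, w). stack3 J u v w)"
  by (rule linearI) (auto simp: stack3_def vec_eq_iff split: sum.split)

lemma block3_saddle_mult:
  fixes H :: "real ^ 'n ^ 'n" and A :: "real ^ 'n ^ 'm"
  shows "block3 J H (transpose A) 0 A 0 0 0 0 (mat 1) *v h =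
    stack3 J (H *v x_part h + sub_transpose_mult A J (l_part h)) (A *v x_part h) (l_part h)"
proof -
  have sum_plus: "(\<Sum>c\<in>UNIV. g c) = (\<Sum>j\<in>UNIV. g (Inl j)) + (\<Sum>i\<in>UNIV. g (Inr i))"
    for g :: "'n + 'm \<Rightarrow> real"
    using sum.Plus[of UNIV UNIV g] by simp
  have restrict: "(\<Sum>i\<in>UNIV. (if i \<in> J then g i else 0) * k i) = (\<Sum>i\<in>J. k i * g i)"
    for g k :: "'m \<Rightarrow> real"
    by (rule sum.mono_neutral_cong_right) auto
  have diagonal: "(\<Sum>j\<in>UNIV. (if j \<in> J then 0 else if i = j then 1 else 0) * k j) = k i"
    if "i \<notin> J" for i and k :: "'m \<Rightarrow> real"
  proof -
    have "(\<Sum>j\<in>UNIV. (if j \<in> J then 0 else if i = j then 1 else 0) * k j) =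
        (\<Sum>j\<in>UNIV. if i = j then k j else 0)"
      by (rule sum.cong) (use that in auto)
    then show ?thesis by simp
  qed
  show ?thesis
    by (auto simp: vec_eq_iff stack3_def block3_def matrix_vector_mult_def sum_plus x_part_def
        l_part_def sub_transpose_mult_component transpose_def restrict diagonal mat_def
        split: sum.split cong: if_cong)
qed

lemma F_map_has_derivative:
  fixes f :: "real ^ 'n \<Rightarrow> real" and A :: "real ^ 'n ^ 'm"
  assumes "gradient f differentiable (at (x_part w))"
  shows "(F_map f A b J has_derivative
      (\<lambda>h. block3 J (hessian f (x_part w)) (transpose A) 0 A 0 0 0 0 (mat 1) *v h)) (at w)"
proof -
  note has_derivative_linear =
    bounded_linear_imp_has_derivative[OF linear_conv_bounded_linear[THEN iffD1]]
  have grad: "(gradient f has_derivative (*v) (hessian f (x_part w))) (at (x_part w))"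
    using assms unfolding hessian_def jacobian_works .
  have x: "(x_part has_derivative x_part) (at w)"
    by (rule has_derivative_linear[OF linear_x_part])
  have l: "(l_part has_derivative l_part) (at w)"
    by (rule has_derivative_linear[OF linear_l_part])
  have gradx: "((\<lambda>w. gradient f (x_part w)) has_derivative (\<lambda>h. hessian f (x_part w) *v x_part h))
      (at w)"
    using has_derivative_compose[OF x grad] .
  have stm: "((\<lambda>w. sub_transpose_mult A J (l_part w)) has_derivative
      (\<lambda>h. sub_transpose_mult A J (l_part h))) (at w)"
    by (rule has_derivative_compose[OF l has_derivative_linear[OF linear_sub_transpose_mult]])
  have Ax: "((\<lambda>w. A *v x_part w) has_derivative (\<lambda>h. A *v x_part h)) (at w)"
    by (rule has_derivative_compose[OF x has_derivative_linear[OF matrix_vector_mul_linear]])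
  have Axb: "((\<lambda>w. A *v x_part w - b) has_derivative (\<lambda>h. A *v x_part h)) (at w)"
    using has_derivative_diff[OF Ax has_derivative_const] by simp
  have "((\<lambda>w. (\<lambda>(u, v, w). stack3 J u v w)
        (gradient f (x_part w) + sub_transpose_mult A J (l_part w), A *v x_part w - b, l_part w))
      has_derivative (\<lambda>h. (\<lambda>(u, v, w). stack3 J u v w)
        (hessian f (x_part w) *v x_part h + sub_transpose_mult A J (l_part h),
         A *v x_part h, l_part h))) (at w)"
    by (intro has_derivative_compose[OF _ has_derivative_linear[OF linear_stack3]]
        has_derivative_Pair has_derivative_add gradx stm Axb l)
  then show ?thesis
    by (simp add: block3_saddle_mult F_map_def[abs_def])
qed

lemma jacobian_eqI:
  fixes F :: "real ^ 'a \<Rightarrow> real ^ 'b"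
  assumes "(F has_derivative (\<lambda>h. M *v h)) (at w)"
  shows "jacobian F (at w) = M"
proof -
  have "frechet_derivative F (at w) = (*v) M"
    using frechet_derivative_at[OF assms] by simp
  then show ?thesis by (simp add: jacobian_def)
qed


section \<open>Nonsingularity\<close>

text \<open>The dimension is at most the number of distinct rows, which is at most \<open>card J\<close>.  Equality
  throughout makes the rows distinct and independent.\<close>

lemma full_row_rank_imp_coeffs_zero:
  fixes A :: "real ^ 'n ^ 'm"
  assumes rank: "full_row_rank A J"
    and zero: "sub_transpose_mult A J q = 0" and i: "i \<in> J"
  shows "q $ i = 0"
proof -
  define R where "R = (\<lambda>i. row i A) ` J"
  have dimR: "dim R = card J"
    using rank by (simp add: full_row_rank_def R_def image_def Bex_def setcompr_eq_image)
  have "dim R \<le> card R" by (rule dim_le_card') (simp add: R_def)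
  moreover have "card R \<le> card J" unfolding R_def by (rule card_image_le) simp
  ultimately have cardR: "card R = card J" using dimR by simp
  then have inj: "inj_on (\<lambda>i. row i A) J" unfolding R_def by (intro eq_card_imp_inj_on) auto
  have indep: "independent R"
    by (rule card_le_dim_spanning[of R R]) (use cardR dimR in \<open>simp_all add: span_superset R_def\<close>)
  define c where "c = (\<lambda>r. q $ inv_into J (\<lambda>i. row i A) r)"
  have "(\<Sum>r\<in>R. c r *\<^sub>R r) = (\<Sum>i\<in>J. c (row i A) *\<^sub>R row i A)"
    unfolding R_def by (simp add: sum.reindex[OF inj])
  also have "\<dots> = (\<Sum>i\<in>J. q $ i *\<^sub>R row i A)"
    by (rule sum.cong) (simp_all add: c_def inv_into_f_f[OF inj])
  also have "\<dots> = 0" using zero by (simp add: sub_transpose_mult_def)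
  finally have "(\<Sum>r\<in>R. c r *\<^sub>R r) = 0" .
  moreover have "finite R" "row i A \<in> R" using i by (simp_all add: R_def)
  ultimately have "c (row i A) = 0"
    using independentD[OF indep _ subset_refl] by blast
  then show ?thesis using i by (simp add: c_def inv_into_f_f[OF inj])
qed

lemma saddle_matrix_invertible:
  fixes H :: "real ^ 'n ^ 'n" and A :: "real ^ 'n ^ 'm"
  assumes pd: "positive_definite H" and rank: "full_row_rank A J"
  shows "invertible (block3 J H (transpose A) 0 A 0 0 0 0 (mat 1))"
proof -
  have "h = 0" if "block3 J H (transpose A) 0 A 0 0 0 0 (mat 1) *v h = 0" for h
  proof -
    define p where "p = x_part h"
    define q where "q = l_part h"
    have first: "H *v p + sub_transpose_mult A J q = 0"
      and second: "\<And>i. i \<in> J \<Longrightarrow> (A *v p) $ i = 0"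
      and third: "\<And>i. i \<notin> J \<Longrightarrow> q $ i = 0"
      using that by (auto simp: block3_saddle_mult stack3_eq_0_iff p_def q_def)
    have "p \<bullet> row i A = (A *v p) $ i" for i
      by (simp add: matrix_vector_mul_component row_def inner_commute vec_lambda_eta)
    then have "p \<bullet> sub_transpose_mult A J q = 0"
      by (simp add: sub_transpose_mult_def inner_sum_right second)
    then have "p \<bullet> (H *v p) = p \<bullet> (H *v p + sub_transpose_mult A J q)"
      by (simp add: inner_add_right)
    then have "p \<bullet> (H *v p) = 0" using first by simp
    then have p0: "p = 0" using pd unfolding positive_definite_def by force
    then have "sub_transpose_mult A J q = 0" using first by simp
    then have "q $ i = 0" for i
      using full_row_rank_imp_coeffs_zero[OF rank] third by blast
    then have "h $ Inr i = 0" for i by (simp add: q_def l_part_def)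
    moreover have "h $ Inl j = 0" for j
      using p0 by (simp add: p_def x_part_def vec_eq_iff)
    ultimately show "h = 0" unfolding vec_eq_iff zero_index by (metis sum.exhaust)
  qed
  then show ?thesis
    unfolding invertible_left_inverse matrix_left_invertible_ker by blast
qed


theorem theorem4p1:
  fixes f :: "real ^ 'n \<Rightarrow> real"
    and A :: "real ^ 'n ^ 'm"
    and b :: "real ^ 'm"
    and s :: nat
    and \<tau> :: real
    and x :: "real ^ 'n"
    and J :: "'m set"
  assumes f_C1: "continuously_differentiable f"
    and m_le_n: "CARD('m) \<le> CARD('n)"
    and s_pos: "0 < s"
    and s_less: "s < CARD('m)"
    and tau_pos: "\<tau> > 0"
    and J_eq: "J = {i. (A *v x - b) $ i = 0}"
  shows "(tau_stationary f A b s \<tau> x \<longleftrightarrow>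
           (\<exists>l. J \<in> T_sets (A *v x - b + \<tau> *\<^sub>R l) s \<and> F_map f A b J (pair_vec x l) = 0))
    \<and> (twice_continuously_differentiable f \<longrightarrow>
        (\<forall>l. F_map f A b J differentiable (at (pair_vec x l)) \<and>
             jacobian (F_map f A b J) (at (pair_vec x l)) =
               block3 J
                 (hessian f x) (transpose A) 0
                 A             0             0
                 0             0             (mat 1) \<and>
             (positive_definite (hessian f x) \<and> full_row_rank A J \<longrightarrow>
                invertible (jacobian (F_map f A b J) (at (pair_vec x l))))))"
proof (intro conjI impI allI)
  show "tau_stationary f A b s \<tau> x \<longleftrightarrow>
      (\<exists>l. J \<in> T_sets (A *v x - b + \<tau> *\<^sub>R l) s \<and> F_map f A b J (pair_vec x l) = 0)"
    using tau_pos J_eq by (intro tau_stationary_iff_F_map_eq_0) auto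
next
  fix l
  assume C2: "twice_continuously_differentiable f"
  let ?M = "block3 J (hessian f x) (transpose A) 0 A 0 0 0 0 (mat 1)"
  have deriv: "(F_map f A b J has_derivative (\<lambda>h. ?M *v h)) (at (pair_vec x l))"
    using F_map_has_derivative[of f "pair_vec x l" A b J] C2
    by (simp add: twice_continuously_differentiable_def)
  then show "F_map f A b J differentiable (at (pair_vec x l))"
    by (rule differentiableI)
  show jac: "jacobian (F_map f A b J) (at (pair_vec x l)) = ?M"
    using deriv by (rule jacobian_eqI)
  assume "positive_definite (hessian f x) \<and> full_row_rank A J"
  then show "invertible (jacobian (F_map f A b J) (at (pair_vec x l)))"
    unfolding jac by (intro saddle_matrix_invertible) auto
qed

end
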